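(* Let $L:\mathcal{B}\to\mathcal{A}$ be left adjoint to $R:\mathcal{A}\to\mathcal{B}$, with unit $\eta$ and counit $\epsilon$. (1) $L$ is h-separable if and only if the monad $(RL,R\epsilon L,\eta)$ on $\mathcal B$ has an augmentation. (2) $R$ is h-separable if and only if the comonad $(LR,L\eta R,\epsilon)$ on $\mathcal A$ has a grouplike morphism.
   Context: A functor $F:\mathcal{B}\to\mathcal{A}$ is h-separable (heavily separable) if there are maps $P_{X,Y}:\mathrm{Hom}_{\mathcal{A}}(FX,FY)\to\mathrm{Hom}_{\mathcal{B}}(X,Y)$, natural in $X,Y\in\mathcal{B}$, such that $P_{X,Y}(Ff)=f$ for every $f:X\to Y$ in $\mathcal{B}$, and $P_{X,Z}(f\circ g)=P_{Y,Z}(f)\circ P_{X,Y}(g)$ for all $X,Y,Z\in\mathcal{B}$ and all $g:FX\to FY$, $f:FY\to FZ$ in $\mathcal{A}$. An augmentation of a monad $(M,m:MM\to M,\eta:\mathrm{Id}\to M)$ is a natural transformation $\gamma:M\to\mathrm{Id}$ such that $\gamma\circ\eta=\mathrm{Id}$ and $\gamma\gamma=\gamma\circ m$. A grouplike morphism for a comonad $(C,\Delta:C\to CC,\epsilon:C\to\mathrm{Id})$ is a natural transformation $\delta:\mathrm{Id}\to C$ such that $\epsilon\circ\delta=\mathrm{Id}$ and $\delta\delta=\Delta\circ\delta$. Here $\gamma\gamma=\gamma\circ M\gamma$ and $\delta\delta=C\delta\circ\delta$ are horizontal composites. *)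

theory Defs
  imports Main
begin

section \<open>Categories, functors and natural transformations\<close>

text \<open>Composition is in applicative order: \<open>g \<cdot> f\<close> is ``\<open>g\<close> after \<open>f\<close>''. The operations are
  unspecified outside of the object and arrow sets.\<close>

record ('o, 'a) category =
  Obj :: "'o set"
  Arr :: "'a set"
  Dom :: "'a \<Rightarrow> 'o"
  Cod :: "'a \<Rightarrow> 'o"
  Ide :: "'o \<Rightarrow> 'a"
  Comp :: "'a \<Rightarrow> 'a \<Rightarrow> 'a"  (infixr "\<cdot>\<index>" 75)

definition Hom :: "('o, 'a, 'm) category_scheme \<Rightarrow> 'o \<Rightarrow> 'o \<Rightarrow> 'a set" where
  "Hom C X Y = {f \<in> Arr C. Dom C f = X \<and> Cod C f = Y}"

locale category =
  fixes C :: "('o, 'a, 'm) category_scheme" (structure)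
  assumes Dom_in_Obj: "f \<in> Arr C \<Longrightarrow> Dom C f \<in> Obj C"
    and Cod_in_Obj: "f \<in> Arr C \<Longrightarrow> Cod C f \<in> Obj C"
    and Ide_in_Hom: "X \<in> Obj C \<Longrightarrow> Ide C X \<in> Hom C X X"
    and Comp_in_Hom: "f \<in> Hom C X Y \<Longrightarrow> g \<in> Hom C Y Z \<Longrightarrow> g \<cdot> f \<in> Hom C X Z"
    and Comp_Ide_right: "f \<in> Hom C X Y \<Longrightarrow> f \<cdot> Ide C X = f"
    and Comp_Ide_left: "f \<in> Hom C X Y \<Longrightarrow> Ide C Y \<cdot> f = f"
    and Comp_assoc: "f \<in> Hom C W X \<Longrightarrow> g \<in> Hom C X Y \<Longrightarrow> h \<in> Hom C Y Z \<Longrightarrow>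
      (h \<cdot> g) \<cdot> f = h \<cdot> (g \<cdot> f)"

record ('o1, 'a1, 'o2, 'a2) functor_data =
  on_obj :: "'o1 \<Rightarrow> 'o2"
  on_arr :: "'a1 \<Rightarrow> 'a2"

definition id_functor :: "('o, 'a, 'o, 'a) functor_data" where
  "id_functor = \<lparr>on_obj = (\<lambda>X. X), on_arr = (\<lambda>f. f)\<rparr>"

definition comp_functor ::
  "('o2, 'a2, 'o3, 'a3) functor_data \<Rightarrow> ('o1, 'a1, 'o2, 'a2) functor_data \<Rightarrow>
   ('o1, 'a1, 'o3, 'a3) functor_data"  (infixr "\<circ>\<^sub>F" 70) where
  "G \<circ>\<^sub>F F = \<lparr>on_obj = (\<lambda>X. on_obj G (on_obj F X)), on_arr = (\<lambda>f. on_arr G (on_arr F f))\<rparr>"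

locale is_functor = dom: category C + cod: category D
  for C :: "('o1, 'a1, 'm1) category_scheme" and D :: "('o2, 'a2, 'm2) category_scheme" +
  fixes F :: "('o1, 'a1, 'o2, 'a2) functor_data"
  assumes on_obj: "X \<in> Obj C \<Longrightarrow> on_obj F X \<in> Obj D"
    and on_arr: "f \<in> Hom C X Y \<Longrightarrow> on_arr F f \<in> Hom D (on_obj F X) (on_obj F Y)"
    and on_Ide: "X \<in> Obj C \<Longrightarrow> on_arr F (Ide C X) = Ide D (on_obj F X)"
    and on_Comp: "f \<in> Hom C X Y \<Longrightarrow> g \<in> Hom C Y Z \<Longrightarrow>
      on_arr F (g \<cdot>\<^bsub>C\<^esub> f) = on_arr F g \<cdot>\<^bsub>D\<^esub> on_arr F f"

text \<open>A natural transformation is given by its family of components, indexed by the objects of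
  the source category.\<close>

locale nat_trans = src: is_functor C D F + tgt: is_functor C D G
  for C :: "('o1, 'a1, 'm1) category_scheme" and D :: "('o2, 'a2, 'm2) category_scheme"
    and F G :: "('o1, 'a1, 'o2, 'a2) functor_data" +
  fixes \<alpha> :: "'o1 \<Rightarrow> 'a2"
  assumes component: "X \<in> Obj C \<Longrightarrow> \<alpha> X \<in> Hom D (on_obj F X) (on_obj G X)"
    and naturality: "f \<in> Hom C X Y \<Longrightarrow> \<alpha> Y \<cdot>\<^bsub>D\<^esub> on_arr F f = on_arr G f \<cdot>\<^bsub>D\<^esub> \<alpha> X"

text \<open>The two whiskerings \<open>H\<alpha>\<close> and \<open>\<alpha>K\<close> of a natural transformation \<open>\<alpha>\<close> with a functor.\<close>

definition whisker_left ::
  "('o2, 'a2, 'o3, 'a3) functor_data \<Rightarrow> ('o1 \<Rightarrow> 'a2) \<Rightarrow> 'o1 \<Rightarrow> 'a3"  (infixr "\<lhd>" 72) where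
  "(H \<lhd> \<alpha>) X = on_arr H (\<alpha> X)"

definition whisker_right ::
  "('o2 \<Rightarrow> 'a3) \<Rightarrow> ('o1, 'a1, 'o2, 'a2) functor_data \<Rightarrow> 'o1 \<Rightarrow> 'a3"  (infixl "\<rhd>" 73) where
  "(\<alpha> \<rhd> K) X = \<alpha> (on_obj K X)"

section \<open>Adjunctions, monads and comonads\<close>

locale adjunction = left: is_functor B A L + right: is_functor A B R +
    unit: nat_trans B B id_functor "R \<circ>\<^sub>F L" \<eta> + counit: nat_trans A A "L \<circ>\<^sub>F R" id_functor \<epsilon>
  for B :: "('o1, 'a1, 'm1) category_scheme" and A :: "('o2, 'a2, 'm2) category_scheme"
    and L :: "('o1, 'a1, 'o2, 'a2) functor_data" and R :: "('o2, 'a2, 'o1, 'a1) functor_data"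
    and \<eta> :: "'o1 \<Rightarrow> 'a1" and \<epsilon> :: "'o2 \<Rightarrow> 'a2" +
  assumes triangle_left: "X \<in> Obj B \<Longrightarrow> (\<epsilon> \<rhd> L) X \<cdot>\<^bsub>A\<^esub> (L \<lhd> \<eta>) X = Ide A (on_obj L X)"
    and triangle_right: "Y \<in> Obj A \<Longrightarrow> (R \<lhd> \<epsilon>) Y \<cdot>\<^bsub>B\<^esub> (\<eta> \<rhd> R) Y = Ide B (on_obj R Y)"

locale monad = endo: is_functor C C M +
    mult: nat_trans C C "M \<circ>\<^sub>F M" M m + unit: nat_trans C C id_functor M \<eta>
  for C :: "('o, 'a, 'm) category_scheme" and M :: "('o, 'a, 'o, 'a) functor_data"
    and m \<eta> :: "'o \<Rightarrow> 'a" +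
  assumes mult_assoc: "X \<in> Obj C \<Longrightarrow> m X \<cdot>\<^bsub>C\<^esub> (M \<lhd> m) X = m X \<cdot>\<^bsub>C\<^esub> (m \<rhd> M) X"
    and unit_left: "X \<in> Obj C \<Longrightarrow> m X \<cdot>\<^bsub>C\<^esub> (\<eta> \<rhd> M) X = Ide C (on_obj M X)"
    and unit_right: "X \<in> Obj C \<Longrightarrow> m X \<cdot>\<^bsub>C\<^esub> (M \<lhd> \<eta>) X = Ide C (on_obj M X)"

locale comonad = endo: is_functor C C W +
    comult: nat_trans C C W "W \<circ>\<^sub>F W" \<Delta> + counit: nat_trans C C W id_functor \<epsilon>
  for C :: "('o, 'a, 'm) category_scheme" and W :: "('o, 'a, 'o, 'a) functor_data"
    and \<Delta> \<epsilon> :: "'o \<Rightarrow> 'a" +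
  assumes comult_coassoc: "X \<in> Obj C \<Longrightarrow> (W \<lhd> \<Delta>) X \<cdot>\<^bsub>C\<^esub> \<Delta> X = (\<Delta> \<rhd> W) X \<cdot>\<^bsub>C\<^esub> \<Delta> X"
    and counit_left: "X \<in> Obj C \<Longrightarrow> (\<epsilon> \<rhd> W) X \<cdot>\<^bsub>C\<^esub> \<Delta> X = Ide C (on_obj W X)"
    and counit_right: "X \<in> Obj C \<Longrightarrow> (W \<lhd> \<epsilon>) X \<cdot>\<^bsub>C\<^esub> \<Delta> X = Ide C (on_obj W X)"

section \<open>Augmentations, grouplike morphisms and heavily separable functors\<close>

text \<open>In the next two definitions the left-hand side of the last condition is the component at
  \<open>X\<close> of the horizontal composite \<open>\<gamma>\<gamma> = \<gamma> \<circ> M\<gamma>\<close>, respectively \<open>\<delta>\<delta> = W\<delta> \<circ> \<delta>\<close>. Both locales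
  include the (co)monad laws.\<close>

locale augmentation = monad C M m \<eta> + aug: nat_trans C C M id_functor \<gamma>
  for C :: "('o, 'a, 'm) category_scheme" and M :: "('o, 'a, 'o, 'a) functor_data"
    and m \<eta> \<gamma> :: "'o \<Rightarrow> 'a" +
  assumes aug_unit: "X \<in> Obj C \<Longrightarrow> \<gamma> X \<cdot>\<^bsub>C\<^esub> \<eta> X = Ide C X"
    and aug_mult: "X \<in> Obj C \<Longrightarrow> \<gamma> X \<cdot>\<^bsub>C\<^esub> (M \<lhd> \<gamma>) X = \<gamma> X \<cdot>\<^bsub>C\<^esub> m X"

locale grouplike_morphism = comonad C W \<Delta> \<epsilon> + grp: nat_trans C C id_functor W \<delta>
  for C :: "('o, 'a, 'm) category_scheme" and W :: "('o, 'a, 'o, 'a) functor_data"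
    and \<Delta> \<epsilon> \<delta> :: "'o \<Rightarrow> 'a" +
  assumes grp_counit: "X \<in> Obj C \<Longrightarrow> \<epsilon> X \<cdot>\<^bsub>C\<^esub> \<delta> X = Ide C X"
    and grp_comult: "X \<in> Obj C \<Longrightarrow> (W \<lhd> \<delta>) X \<cdot>\<^bsub>C\<^esub> \<delta> X = \<Delta> X \<cdot>\<^bsub>C\<^esub> \<delta> X"

text \<open>The family \<open>P\<close> is indexed by the objects of the source category, as \<open>F\<close> need not be
  injective on objects.\<close>

locale heavy_section = is_functor B A F
  for B :: "('o1, 'a1, 'm1) category_scheme" and A :: "('o2, 'a2, 'm2) category_scheme"
    and F :: "('o1, 'a1, 'o2, 'a2) functor_data" +
  fixes P :: "'o1 \<Rightarrow> 'o1 \<Rightarrow> 'a2 \<Rightarrow> 'a1"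
  assumes P_in_Hom: "X \<in> Obj B \<Longrightarrow> Y \<in> Obj B \<Longrightarrow> h \<in> Hom A (on_obj F X) (on_obj F Y) \<Longrightarrow>
      P X Y h \<in> Hom B X Y"
    and P_natural: "u \<in> Hom B X' X \<Longrightarrow> v \<in> Hom B Y Y' \<Longrightarrow>
      h \<in> Hom A (on_obj F X) (on_obj F Y) \<Longrightarrow>
      P X' Y' (on_arr F v \<cdot>\<^bsub>A\<^esub> h \<cdot>\<^bsub>A\<^esub> on_arr F u) = v \<cdot>\<^bsub>B\<^esub> P X Y h \<cdot>\<^bsub>B\<^esub> u"
    and P_section: "f \<in> Hom B X Y \<Longrightarrow> P X Y (on_arr F f) = f"
    and P_Comp: "X \<in> Obj B \<Longrightarrow> Y \<in> Obj B \<Longrightarrow> Z \<in> Obj B \<Longrightarrow>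
      h \<in> Hom A (on_obj F X) (on_obj F Y) \<Longrightarrow> k \<in> Hom A (on_obj F Y) (on_obj F Z) \<Longrightarrow>
      P X Z (k \<cdot>\<^bsub>A\<^esub> h) = P Y Z k \<cdot>\<^bsub>B\<^esub> P X Y h"

definition h_separable ::
  "('o1, 'a1, 'm1) category_scheme \<Rightarrow> ('o2, 'a2, 'm2) category_scheme \<Rightarrow>
   ('o1, 'a1, 'o2, 'a2) functor_data \<Rightarrow> bool" where
  "h_separable B A F \<longleftrightarrow> (\<exists>P. heavy_section B A F P)"

end

theory Submission
  imports Defs
begin

text \<open>A section \<open>P\<close> of \<open>L\<close> on hom-sets, natural in both variables, is determined by its values on the
  counit: by the adjunction every \<open>h : LX \<rightarrow> LY\<close> is \<open>\<epsilon>\<^bsub>LY\<^esub> \<cdot> L(Rh \<cdot> \<eta>\<^bsub>X\<^esub>)\<close>, so that naturality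
  gives \<open>P h = P(\<epsilon>\<^bsub>LY\<^esub>) \<cdot> Rh \<cdot> \<eta>\<^bsub>X\<^esub>\<close>. Hence \<open>P\<close> and the family \<open>\<gamma>\<^bsub>X\<^esub> = P(\<epsilon>\<^bsub>LX\<^esub>) : RLX \<rightarrow> X\<close> carry
  the same information, in the manner of the Yoneda lemma. Under this correspondence naturality of
  \<open>P\<close> in the target becomes naturality of \<open>\<gamma>\<close>, the section property becomes \<open>\<gamma> \<cdot> \<eta> = Id\<close>, and
  multiplicativity of \<open>P\<close> becomes compatibility of \<open>\<gamma>\<close> with the multiplication \<open>R\<epsilon>L\<close>. The two
  directions are \<open>augmentation_of_heavy_section\<close> and \<open>heavy_section_of_augmentation\<close>.

  The claim on \<open>R\<close> is the same claim for the opposite adjunction, where \<open>R\<close> is left adjoint to \<open>L\<close>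
  with unit \<open>\<epsilon>\<close> and counit \<open>\<eta>\<close>: reversing arrows exchanges comonads with monads and grouplike
  morphisms with augmentations, and preserves heavy separability.\<close>

section \<open>Opposite categories\<close>

text \<open>Updating the fields, instead of building a new record, keeps any further fields and makes
  the construction an involution on the nose.\<close>

definition opposite :: "('o, 'a, 'm) category_scheme \<Rightarrow> ('o, 'a, 'm) category_scheme" where
  "opposite C = C\<lparr>Dom := Cod C, Cod := Dom C, Comp := (\<lambda>g f. f \<cdot>\<^bsub>C\<^esub> g)\<rparr>"

lemma opposite_simps [simp]:
  "Obj (opposite C) = Obj C"
  "Arr (opposite C) = Arr C"
  "Dom (opposite C) = Cod C"
  "Cod (opposite C) = Dom C"
  "Ide (opposite C) = Ide C"
  "g \<cdot>\<^bsub>opposite C\<^esub> f = f \<cdot>\<^bsub>C\<^esub> g"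
  by (simp_all add: opposite_def)

lemma opposite_opposite [simp]: "opposite (opposite C) = C"
  by (simp add: opposite_def)

lemma Hom_opposite [simp]: "Hom (opposite C) X Y = Hom C Y X"
  by (auto simp: Hom_def)

lemma functor_data_simps [simp]:
  "on_obj id_functor X = X"
  "on_arr id_functor f = f"
  "on_obj (G \<circ>\<^sub>F F) X = on_obj G (on_obj F X)"
  "on_arr (G \<circ>\<^sub>F F) f = on_arr G (on_arr F f)"
  by (simp_all add: id_functor_def comp_functor_def)

lemma whisker_simps [simp]:
  "(H \<lhd> \<alpha>) X = on_arr H (\<alpha> X)"
  "(\<beta> \<rhd> K) X = \<beta> (on_obj K X)"
  by (simp_all add: whisker_left_def whisker_right_def)

lemma (in category) Hom_ObjD:
  assumes "f \<in> Hom C X Y"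
  shows "X \<in> Obj C" "Y \<in> Obj C"
  using assms Dom_in_Obj Cod_in_Obj by (auto simp: Hom_def)

lemma category_opposite:
  assumes "category C"
  shows "category (opposite C)"
proof -
  interpret category C by fact
  show ?thesis
    by unfold_locales
      (auto simp: Dom_in_Obj Cod_in_Obj Ide_in_Hom Comp_in_Hom Comp_Ide_left Comp_Ide_right
        Comp_assoc)
qed

lemma is_functor_opposite:
  assumes "is_functor C D F"
  shows "is_functor (opposite C) (opposite D) F"
proof -
  interpret is_functor C D F by fact
  show ?thesis
    by (intro is_functor.intro is_functor_axioms.intro category_opposite)
      (auto simp: on_obj on_arr on_Ide on_Comp intro: dom.category_axioms cod.category_axioms)
qed

lemma nat_trans_opposite:
  assumes "nat_trans C D F G \<alpha>"
  shows "nat_trans (opposite C) (opposite D) G F \<alpha>"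
proof -
  interpret nat_trans C D F G \<alpha> by fact
  show ?thesis
    by (intro nat_trans.intro nat_trans_axioms.intro is_functor_opposite)
      (auto simp: component naturality intro: src.is_functor_axioms tgt.is_functor_axioms)
qed

lemma adjunction_opposite:
  assumes "adjunction B A L R \<eta> \<epsilon>"
  shows "adjunction (opposite A) (opposite B) R L \<epsilon> \<eta>"
proof -
  interpret adjunction B A L R \<eta> \<epsilon> by fact
  show ?thesis
    by (intro adjunction.intro adjunction_axioms.intro is_functor_opposite nat_trans_opposite
          left.is_functor_axioms right.is_functor_axioms
          unit.nat_trans_axioms counit.nat_trans_axioms)
      (use triangle_left triangle_right in auto)
qed

lemma monad_opposite:
  assumes "comonad C W \<Delta> \<epsilon>"
  shows "monad (opposite C) W \<Delta> \<epsilon>"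
proof -
  interpret comonad C W \<Delta> \<epsilon> by fact
  show ?thesis
    by (intro monad.intro monad_axioms.intro is_functor_opposite nat_trans_opposite
          endo.is_functor_axioms comult.nat_trans_axioms counit.nat_trans_axioms)
      (use comult_coassoc counit_left counit_right in auto)
qed

lemma comonad_opposite:
  assumes "monad C M m \<eta>"
  shows "comonad (opposite C) M m \<eta>"
proof -
  interpret monad C M m \<eta> by fact
  show ?thesis
    by (intro comonad.intro comonad_axioms.intro is_functor_opposite nat_trans_opposite
          endo.is_functor_axioms mult.nat_trans_axioms unit.nat_trans_axioms)
      (use mult_assoc unit_left unit_right in auto)
qed

lemma augmentation_opposite:
  assumes "grouplike_morphism C W \<Delta> \<epsilon> \<delta>"
  shows "augmentation (opposite C) W \<Delta> \<epsilon> \<delta>"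
proof -
  interpret grouplike_morphism C W \<Delta> \<epsilon> \<delta> by fact
  show ?thesis
    by (intro augmentation.intro augmentation_axioms.intro monad_opposite nat_trans_opposite
          comonad_axioms grp.nat_trans_axioms)
      (use grp_counit grp_comult in auto)
qed

lemma grouplike_morphism_opposite:
  assumes "augmentation C M m \<eta> \<gamma>"
  shows "grouplike_morphism (opposite C) M m \<eta> \<gamma>"
proof -
  interpret augmentation C M m \<eta> \<gamma> by fact
  show ?thesis
    by (intro grouplike_morphism.intro grouplike_morphism_axioms.intro comonad_opposite
          nat_trans_opposite monad_axioms aug.nat_trans_axioms)
      (use aug_unit aug_mult in auto)
qed

lemma augmentation_opposite_iff:
  "augmentation (opposite C) W \<Delta> \<epsilon> \<delta> \<longleftrightarrow> grouplike_morphism C W \<Delta> \<epsilon> \<delta>"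
  using augmentation_opposite grouplike_morphism_opposite[of "opposite C" W \<Delta> \<epsilon> \<delta>] by auto

lemma h_separable_opposite:
  assumes "h_separable B A F"
  shows "h_separable (opposite B) (opposite A) F"
proof -
  obtain P where "heavy_section B A F P"
    using assms by (auto simp: h_separable_def)
  then interpret heavy_section B A F P .
  have "heavy_section (opposite B) (opposite A) F (\<lambda>X Y. P Y X)"
  proof (intro heavy_section.intro heavy_section_axioms.intro)
    show "is_functor (opposite B) (opposite A) F"
      by (rule is_functor_opposite) unfold_locales
  next
    \<comment> \<open>In the opposite category the triple composites in naturality are bracketed the other way.\<close>
    fix u v h X' X Y Y'
    assume u: "u \<in> Hom (opposite B) X' X" and v: "v \<in> Hom (opposite B) Y Y'"
      and h: "h \<in> Hom (opposite A) (on_obj F X) (on_obj F Y)"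
    have u': "u \<in> Hom B X X'" and v': "v \<in> Hom B Y' Y"
      and h': "h \<in> Hom A (on_obj F Y) (on_obj F X)"
      using u v h by simp_all
    have "(on_arr F u \<cdot>\<^bsub>A\<^esub> h) \<cdot>\<^bsub>A\<^esub> on_arr F v = on_arr F u \<cdot>\<^bsub>A\<^esub> h \<cdot>\<^bsub>A\<^esub> on_arr F v"
      by (rule cod.Comp_assoc[OF on_arr[OF v'] h' on_arr[OF u']])
    moreover have "(u \<cdot>\<^bsub>B\<^esub> P Y X h) \<cdot>\<^bsub>B\<^esub> v = u \<cdot>\<^bsub>B\<^esub> P Y X h \<cdot>\<^bsub>B\<^esub> v"
      using dom.Comp_assoc[OF v' P_in_Hom u'] h' dom.Hom_ObjD[OF u'] dom.Hom_ObjD[OF v'] by blast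
    ultimately show "P Y' X' (on_arr F v \<cdot>\<^bsub>opposite A\<^esub> h \<cdot>\<^bsub>opposite A\<^esub> on_arr F u) =
        v \<cdot>\<^bsub>opposite B\<^esub> P Y X h \<cdot>\<^bsub>opposite B\<^esub> u"
      using P_natural[OF v' u' h'] by simp
  qed (auto simp: P_in_Hom P_section P_Comp)
  then show ?thesis
    by (auto simp: h_separable_def)
qed

lemma h_separable_opposite_iff:
  "h_separable (opposite B) (opposite A) F \<longleftrightarrow> h_separable B A F"
  using h_separable_opposite h_separable_opposite[of "opposite B" "opposite A" F] by auto

section \<open>The monad of an adjunction\<close>

lemma is_functor_comp:
  assumes "is_functor C D F" "is_functor D E G"
  shows "is_functor C E (G \<circ>\<^sub>F F)"
proof -
  interpret F: is_functor C D F by fact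
  interpret G: is_functor D E G by fact
  show ?thesis
    by unfold_locales
      (auto simp: F.on_obj G.on_obj F.on_Ide G.on_Ide F.on_Comp G.on_Comp[OF F.on_arr F.on_arr]
        intro: F.on_arr G.on_arr)
qed

context adjunction
begin

lemma unit_component: "X \<in> Obj B \<Longrightarrow> \<eta> X \<in> Hom B X (on_obj R (on_obj L X))"
  using unit.component by simp

lemma counit_component: "Y \<in> Obj A \<Longrightarrow> \<epsilon> Y \<in> Hom A (on_obj L (on_obj R Y)) Y"
  using counit.component by simp

lemma unit_naturality:
  "f \<in> Hom B X Y \<Longrightarrow> \<eta> Y \<cdot>\<^bsub>B\<^esub> f = on_arr R (on_arr L f) \<cdot>\<^bsub>B\<^esub> \<eta> X"
  using unit.naturality by simp

lemma counit_naturality: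
  "g \<in> Hom A X Y \<Longrightarrow> \<epsilon> Y \<cdot>\<^bsub>A\<^esub> on_arr L (on_arr R g) = g \<cdot>\<^bsub>A\<^esub> \<epsilon> X"
  using counit.naturality by simp

lemma R_counit_naturality:
  assumes "g \<in> Hom A X Y"
  shows "on_arr R (\<epsilon> Y) \<cdot>\<^bsub>B\<^esub> on_arr R (on_arr L (on_arr R g)) = on_arr R g \<cdot>\<^bsub>B\<^esub> on_arr R (\<epsilon> X)"
proof -
  have objs: "X \<in> Obj A" "Y \<in> Obj A"
    using assms left.cod.Hom_ObjD by auto
  have "on_arr R (\<epsilon> Y) \<cdot>\<^bsub>B\<^esub> on_arr R (on_arr L (on_arr R g)) =
      on_arr R (\<epsilon> Y \<cdot>\<^bsub>A\<^esub> on_arr L (on_arr R g))"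
    using right.on_Comp[OF left.on_arr[OF right.on_arr[OF assms]] counit_component[OF objs(2)]]
    by simp
  also have "\<dots> = on_arr R g \<cdot>\<^bsub>B\<^esub> on_arr R (\<epsilon> X)"
    using right.on_Comp[OF counit_component[OF objs(1)] assms] counit_naturality[OF assms] by simp
  finally show ?thesis .
qed

lemma R_triangle_left:
  assumes "X \<in> Obj B"
  shows "on_arr R (\<epsilon> (on_obj L X)) \<cdot>\<^bsub>B\<^esub> on_arr R (on_arr L (\<eta> X)) =
    Ide B (on_obj R (on_obj L X))"
  using right.on_Comp[OF left.on_arr[OF unit_component[OF assms]]
      counit_component[OF left.on_obj[OF assms]]]
    triangle_left[OF assms] right.on_Ide[OF left.on_obj[OF assms]] by simp

lemma monad_of_adjunction: "monad B (R \<circ>\<^sub>F L) (R \<lhd> \<epsilon> \<rhd> L) \<eta>"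
proof -
  have RL: "is_functor B B (R \<circ>\<^sub>F L)"
    by (rule is_functor_comp[OF left.is_functor_axioms right.is_functor_axioms])
  have mult: "nat_trans B B ((R \<circ>\<^sub>F L) \<circ>\<^sub>F (R \<circ>\<^sub>F L)) (R \<circ>\<^sub>F L) (R \<lhd> \<epsilon> \<rhd> L)"
    by (intro nat_trans.intro nat_trans_axioms.intro RL is_functor_comp[OF RL RL])
      (auto simp: R_counit_naturality left.on_arr left.on_obj counit_component
        intro!: right.on_arr)
  show ?thesis
    by (intro monad.intro monad_axioms.intro RL mult unit.nat_trans_axioms)
      (use R_counit_naturality R_triangle_left left.on_obj counit_component triangle_right
        in auto)
qed

section \<open>Augmentations and heavy sections\<close>

text \<open>The component \<open>\<gamma>\<^bsub>X\<^esub> = P(\<epsilon>\<^bsub>LX\<^esub>)\<close> inherits each law from one of the counit: naturality of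
  \<open>\<gamma>\<close> from naturality of \<open>\<epsilon>\<close>, the unit law from the triangle identity \<open>\<epsilon>\<^bsub>LX\<^esub> \<cdot> L\<eta>\<^bsub>X\<^esub> = Id\<close>, and
  the multiplication law from \<open>\<epsilon>\<^bsub>LX\<^esub> \<cdot> \<epsilon>\<^bsub>LRLX\<^esub> = \<epsilon>\<^bsub>LX\<^esub> \<cdot> LR\<epsilon>\<^bsub>LX\<^esub>\<close>.\<close>

lemma augmentation_of_heavy_section:
  assumes "heavy_section B A L P"
  shows "augmentation B (R \<circ>\<^sub>F L) (R \<lhd> \<epsilon> \<rhd> L) \<eta>
    (\<lambda>X. P (on_obj R (on_obj L X)) X (\<epsilon> (on_obj L X)))"
proof -
  interpret heavy_section B A L P by fact
  interpret monad B "R \<circ>\<^sub>F L" "R \<lhd> \<epsilon> \<rhd> L" \<eta> by (rule monad_of_adjunction)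
  define M where "M X = on_obj R (on_obj L X)" for X
  define \<gamma> where "\<gamma> X = P (M X) X (\<epsilon> (on_obj L X))" for X
  have M: "M X \<in> Obj B" if "X \<in> Obj B" for X
    using that by (simp add: M_def left.on_obj right.on_obj)
  have counit: "\<epsilon> (on_obj L X) \<in> Hom A (on_obj L (M X)) (on_obj L X)" if "X \<in> Obj B" for X
    using that by (simp add: M_def left.on_obj counit_component)
  have \<gamma>: "\<gamma> X \<in> Hom B (M X) X" if "X \<in> Obj B" for X
    using that by (simp add: \<gamma>_def M counit P_in_Hom)
  \<comment> \<open>Naturality in a single variable, read as multiplicativity with one factor of the form \<open>Lf\<close>.\<close>
  have P_precomp: "P X Y (h \<cdot>\<^bsub>A\<^esub> on_arr L f) = P Z Y h \<cdot>\<^bsub>B\<^esub> f"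
    if "f \<in> Hom B X Z" "Y \<in> Obj B" "h \<in> Hom A (on_obj L Z) (on_obj L Y)" for X Y Z f h
    using that P_Comp[of X Z Y "on_arr L f" h] left.dom.Hom_ObjD left.on_arr P_section by auto
  have P_postcomp: "P X Y (on_arr L f \<cdot>\<^bsub>A\<^esub> h) = f \<cdot>\<^bsub>B\<^esub> P X Z h"
    if "f \<in> Hom B Z Y" "X \<in> Obj B" "h \<in> Hom A (on_obj L X) (on_obj L Z)" for X Y Z f h
    using that P_Comp[of X Z Y h "on_arr L f"] left.dom.Hom_ObjD left.on_arr P_section by auto
  have natural: "\<gamma> Y \<cdot>\<^bsub>B\<^esub> on_arr R (on_arr L f) = f \<cdot>\<^bsub>B\<^esub> \<gamma> X" if f: "f \<in> Hom B X Y" for X Y f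
  proof -
    have objs: "X \<in> Obj B" "Y \<in> Obj B"
      using f left.dom.Hom_ObjD by auto
    have "on_arr R (on_arr L f) \<in> Hom B (M X) (M Y)"
      unfolding M_def by (intro right.on_arr left.on_arr f)
    then have "\<gamma> Y \<cdot>\<^bsub>B\<^esub> on_arr R (on_arr L f) =
        P (M X) Y (\<epsilon> (on_obj L Y) \<cdot>\<^bsub>A\<^esub> on_arr L (on_arr R (on_arr L f)))"
      using P_precomp objs counit by (simp add: \<gamma>_def)
    also have "\<dots> = P (M X) Y (on_arr L f \<cdot>\<^bsub>A\<^esub> \<epsilon> (on_obj L X))"
      using counit_naturality[OF left.on_arr[OF f]] by simp
    also have "\<dots> = f \<cdot>\<^bsub>B\<^esub> \<gamma> X"
      using P_postcomp[OF f M counit] objs by (simp add: \<gamma>_def)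
    finally show ?thesis .
  qed
  have unit: "\<gamma> X \<cdot>\<^bsub>B\<^esub> \<eta> X = Ide B X" if X: "X \<in> Obj B" for X
  proof -
    have "\<gamma> X \<cdot>\<^bsub>B\<^esub> \<eta> X = P X X (\<epsilon> (on_obj L X) \<cdot>\<^bsub>A\<^esub> on_arr L (\<eta> X))"
      using P_precomp[of "\<eta> X" X "M X" X] X counit unit_component by (simp add: \<gamma>_def M_def)
    also have "\<dots> = P X X (on_arr L (Ide B X))"
      using triangle_left[OF X] left.on_Ide[OF X] by simp
    also have "\<dots> = Ide B X"
      using P_section left.dom.Ide_in_Hom[OF X] by blast
    finally show ?thesis .
  qed
  have mult: "\<gamma> X \<cdot>\<^bsub>B\<^esub> on_arr R (on_arr L (\<gamma> X)) = \<gamma> X \<cdot>\<^bsub>B\<^esub> on_arr R (\<epsilon> (on_obj L X))"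
    if X: "X \<in> Obj B" for X
  proof -
    \<comment> \<open>Both sides are \<open>P\<close> of the composite of two counits.\<close>
    have "\<gamma> X \<cdot>\<^bsub>B\<^esub> on_arr R (on_arr L (\<gamma> X)) = \<gamma> X \<cdot>\<^bsub>B\<^esub> \<gamma> (M X)"
      by (rule natural[OF \<gamma>[OF X]])
    also have "\<dots> = P (M (M X)) X (\<epsilon> (on_obj L X) \<cdot>\<^bsub>A\<^esub> \<epsilon> (on_obj L (M X)))"
      using P_Comp[OF M M X counit counit] X M by (simp add: \<gamma>_def)
    also have "\<dots> = P (M (M X)) X (\<epsilon> (on_obj L X) \<cdot>\<^bsub>A\<^esub> on_arr L (on_arr R (\<epsilon> (on_obj L X))))"
      using counit_naturality[OF counit[OF X]] by simp
    also have "\<dots> = \<gamma> X \<cdot>\<^bsub>B\<^esub> on_arr R (\<epsilon> (on_obj L X))"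
    proof -
      have "on_arr R (\<epsilon> (on_obj L X)) \<in> Hom B (M (M X)) (M X)"
        using right.on_arr[OF counit[OF X]] by (simp add: M_def)
      then show ?thesis
        using P_precomp X counit by (simp add: \<gamma>_def)
    qed
    finally show ?thesis .
  qed
  have "augmentation B (R \<circ>\<^sub>F L) (R \<lhd> \<epsilon> \<rhd> L) \<eta> \<gamma>"
    by unfold_locales (use \<gamma> natural unit mult in \<open>auto simp: M_def\<close>)
  then show ?thesis
    by (simp add: \<gamma>_def[abs_def] M_def)
qed

text \<open>Naturality and the section property follow from naturality of \<open>\<gamma>\<close> and \<open>\<eta>\<close> and from
  \<open>\<gamma> \<cdot> \<eta> = Id\<close>. Multiplicativity is where the multiplication law enters: \<open>P k \<cdot> P h\<close> differs from
  \<open>P (k \<cdot> h)\<close> by a factor \<open>\<eta>\<^bsub>Y\<^esub> \<cdot> \<gamma>\<^bsub>Y\<^esub>\<close> between \<open>Rk\<close> and \<open>Rh\<close>, and that factor is absorbed by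
  \<open>\<gamma>\<^bsub>Z\<^esub> \<cdot> Rk\<close>.\<close>

lemma heavy_section_of_augmentation:
  assumes "augmentation B (R \<circ>\<^sub>F L) (R \<lhd> \<epsilon> \<rhd> L) \<eta> \<gamma>"
  shows "heavy_section B A L (\<lambda>X Y h. \<gamma> Y \<cdot>\<^bsub>B\<^esub> on_arr R h \<cdot>\<^bsub>B\<^esub> \<eta> X)"
proof -
  interpret augmentation B "R \<circ>\<^sub>F L" "R \<lhd> \<epsilon> \<rhd> L" \<eta> \<gamma> by fact
  define M where "M X = on_obj R (on_obj L X)" for X
  have M: "M X \<in> Obj B" if "X \<in> Obj B" for X
    using that by (simp add: M_def left.on_obj right.on_obj)
  have \<gamma>: "\<gamma> X \<in> Hom B (M X) X" if "X \<in> Obj B" for X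
    using aug.component[OF that] by (simp add: M_def)
  have \<eta>: "\<eta> X \<in> Hom B X (M X)" if "X \<in> Obj B" for X
    using unit_component[OF that] by (simp add: M_def)
  have Rh: "on_arr R h \<in> Hom B (M X) (M Y)" if "h \<in> Hom A (on_obj L X) (on_obj L Y)" for h X Y
    using right.on_arr[OF that] by (simp add: M_def)
  have RL: "on_arr R (on_arr L f) \<in> Hom B (M X) (M Y)" if "f \<in> Hom B X Y" for f X Y
    by (rule Rh[OF left.on_arr[OF that]])
  have natural: "\<gamma> Y \<cdot>\<^bsub>B\<^esub> on_arr R (on_arr L f) = f \<cdot>\<^bsub>B\<^esub> \<gamma> X" if "f \<in> Hom B X Y" for X Y f
    using aug.naturality[OF that] by simp
  note comp = left.dom.Comp_in_Hom
  note assoc = left.dom.Comp_assoc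
  have closed: "on_arr R h \<cdot>\<^bsub>B\<^esub> \<eta> X \<in> Hom B X (M Y)"
    if "X \<in> Obj B" "h \<in> Hom A (on_obj L X) (on_obj L Y)" for X Y h
    using comp[OF \<eta> Rh] that by blast
  show ?thesis
  proof (intro heavy_section.intro heavy_section_axioms.intro left.is_functor_axioms)
    fix X Y h
    assume "X \<in> Obj B" "Y \<in> Obj B" "h \<in> Hom A (on_obj L X) (on_obj L Y)"
    then show "\<gamma> Y \<cdot>\<^bsub>B\<^esub> on_arr R h \<cdot>\<^bsub>B\<^esub> \<eta> X \<in> Hom B X Y"
      using comp[OF closed \<gamma>] by blast
  next
    fix u v h X' X Y Y'
    assume u: "u \<in> Hom B X' X" and v: "v \<in> Hom B Y Y'"
      and h: "h \<in> Hom A (on_obj L X) (on_obj L Y)"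
    have objs: "X \<in> Obj B" "X' \<in> Obj B" "Y \<in> Obj B" "Y' \<in> Obj B"
      using u v left.dom.Hom_ObjD by auto
    note Lu = left.on_arr[OF u] and Lv = left.on_arr[OF v]
    have hu: "h \<cdot>\<^bsub>A\<^esub> on_arr L u \<in> Hom A (on_obj L X') (on_obj L Y)"
      by (rule left.cod.Comp_in_Hom[OF Lu h])
    have "on_arr R (on_arr L v \<cdot>\<^bsub>A\<^esub> h \<cdot>\<^bsub>A\<^esub> on_arr L u) =
        on_arr R (on_arr L v) \<cdot>\<^bsub>B\<^esub> on_arr R h \<cdot>\<^bsub>B\<^esub> on_arr R (on_arr L u)"
      using right.on_Comp[OF hu Lv] right.on_Comp[OF Lu h] by simp
    then have "\<gamma> Y' \<cdot>\<^bsub>B\<^esub> on_arr R (on_arr L v \<cdot>\<^bsub>A\<^esub> h \<cdot>\<^bsub>A\<^esub> on_arr L u) \<cdot>\<^bsub>B\<^esub> \<eta> X' =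
        \<gamma> Y' \<cdot>\<^bsub>B\<^esub> on_arr R (on_arr L v) \<cdot>\<^bsub>B\<^esub> on_arr R h \<cdot>\<^bsub>B\<^esub> on_arr R (on_arr L u) \<cdot>\<^bsub>B\<^esub> \<eta> X'"
      using assoc[OF \<eta>[OF objs(2)] comp[OF RL[OF u] Rh[OF h]] RL[OF v]]
        assoc[OF \<eta>[OF objs(2)] RL[OF u] Rh[OF h]] by simp
    also have "\<dots> = \<gamma> Y' \<cdot>\<^bsub>B\<^esub> on_arr R (on_arr L v) \<cdot>\<^bsub>B\<^esub> (on_arr R h \<cdot>\<^bsub>B\<^esub> \<eta> X) \<cdot>\<^bsub>B\<^esub> u"
      using unit_naturality[OF u] assoc[OF u \<eta>[OF objs(1)] Rh[OF h]] by simp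
    also have "\<dots> = v \<cdot>\<^bsub>B\<^esub> \<gamma> Y \<cdot>\<^bsub>B\<^esub> (on_arr R h \<cdot>\<^bsub>B\<^esub> \<eta> X) \<cdot>\<^bsub>B\<^esub> u"
      using natural[OF v] assoc[OF comp[OF u closed[OF objs(1) h]] RL[OF v] \<gamma>[OF objs(4)]]
        assoc[OF comp[OF u closed[OF objs(1) h]] \<gamma>[OF objs(3)] v] by simp
    also have "\<dots> = v \<cdot>\<^bsub>B\<^esub> (\<gamma> Y \<cdot>\<^bsub>B\<^esub> on_arr R h \<cdot>\<^bsub>B\<^esub> \<eta> X) \<cdot>\<^bsub>B\<^esub> u"
      using assoc[OF u closed[OF objs(1) h] \<gamma>[OF objs(3)]] by simp
    finally show "\<gamma> Y' \<cdot>\<^bsub>B\<^esub> on_arr R (on_arr L v \<cdot>\<^bsub>A\<^esub> h \<cdot>\<^bsub>A\<^esub> on_arr L u) \<cdot>\<^bsub>B\<^esub> \<eta> X' =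
        v \<cdot>\<^bsub>B\<^esub> (\<gamma> Y \<cdot>\<^bsub>B\<^esub> on_arr R h \<cdot>\<^bsub>B\<^esub> \<eta> X) \<cdot>\<^bsub>B\<^esub> u" .
  next
    fix f X Y
    assume f: "f \<in> Hom B X Y"
    then have objs: "X \<in> Obj B" "Y \<in> Obj B"
      using left.dom.Hom_ObjD by auto
    have "\<gamma> Y \<cdot>\<^bsub>B\<^esub> on_arr R (on_arr L f) \<cdot>\<^bsub>B\<^esub> \<eta> X = f \<cdot>\<^bsub>B\<^esub> \<gamma> X \<cdot>\<^bsub>B\<^esub> \<eta> X"
      using natural[OF f] assoc[OF \<eta>[OF objs(1)] RL[OF f] \<gamma>[OF objs(2)]]
        assoc[OF \<eta>[OF objs(1)] \<gamma>[OF objs(1)] f] by simp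
    then show "\<gamma> Y \<cdot>\<^bsub>B\<^esub> on_arr R (on_arr L f) \<cdot>\<^bsub>B\<^esub> \<eta> X = f"
      using aug_unit[OF objs(1)] left.dom.Comp_Ide_right[OF f] by simp
  next
    fix X Y Z h k
    assume objs: "X \<in> Obj B" "Y \<in> Obj B" "Z \<in> Obj B"
      and h: "h \<in> Hom A (on_obj L X) (on_obj L Y)"
      and k: "k \<in> Hom A (on_obj L Y) (on_obj L Z)"
    let ?g = "on_arr R k \<cdot>\<^bsub>B\<^esub> \<eta> Y"
    have g: "?g \<in> Hom B Y (M Z)"
      by (rule closed[OF objs(2) k])
    note RLRk = RL[OF right.on_arr[OF k], folded M_def]
    have counit: "on_arr R (\<epsilon> (on_obj L W)) \<in> Hom B (M (M W)) (M W)" if "W \<in> Obj B" for W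
      using right.on_arr[OF counit_component[OF left.on_obj[OF that]]] by (simp add: M_def)
    \<comment> \<open>Moving \<open>\<gamma>\<^bsub>Y\<^esub>\<close> to the left by naturality produces \<open>\<gamma>\<^bsub>Z\<^esub> \<cdot> \<gamma>\<^bsub>RLZ\<^esub>\<close>, which the
      multiplication law turns into \<open>\<gamma>\<^bsub>Z\<^esub> \<cdot> R\<epsilon>\<^bsub>LZ\<^esub>\<close>; the counit then cancels \<open>\<eta>\<^bsub>Y\<^esub>\<close>.\<close>
    have absorb: "(\<gamma> Z \<cdot>\<^bsub>B\<^esub> ?g) \<cdot>\<^bsub>B\<^esub> \<gamma> Y = \<gamma> Z \<cdot>\<^bsub>B\<^esub> on_arr R k"
    proof -
      have "(\<gamma> Z \<cdot>\<^bsub>B\<^esub> ?g) \<cdot>\<^bsub>B\<^esub> \<gamma> Y = \<gamma> Z \<cdot>\<^bsub>B\<^esub> \<gamma> (M Z) \<cdot>\<^bsub>B\<^esub> on_arr R (on_arr L ?g)"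
        using assoc[OF \<gamma>[OF objs(2)] g \<gamma>[OF objs(3)]] natural[OF g] by simp
      also have "\<dots> = (\<gamma> Z \<cdot>\<^bsub>B\<^esub> on_arr R (on_arr L (\<gamma> Z))) \<cdot>\<^bsub>B\<^esub> on_arr R (on_arr L ?g)"
        using assoc[OF RL[OF g] \<gamma>[OF M[OF objs(3)]] \<gamma>[OF objs(3)]] natural[OF \<gamma>[OF objs(3)]]
        by simp
      also have "\<dots> = (\<gamma> Z \<cdot>\<^bsub>B\<^esub> on_arr R (\<epsilon> (on_obj L Z))) \<cdot>\<^bsub>B\<^esub> on_arr R (on_arr L ?g)"
        using aug_mult[OF objs(3)] by simp
      also have "\<dots> = \<gamma> Z \<cdot>\<^bsub>B\<^esub> on_arr R (\<epsilon> (on_obj L Z)) \<cdot>\<^bsub>B\<^esub> on_arr R (on_arr L ?g)"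
        by (rule assoc[OF RL[OF g] counit[OF objs(3)] \<gamma>[OF objs(3)]])
      also have "on_arr R (\<epsilon> (on_obj L Z)) \<cdot>\<^bsub>B\<^esub> on_arr R (on_arr L ?g) = on_arr R k"
      proof -
        have "on_arr R (on_arr L ?g) =
            on_arr R (on_arr L (on_arr R k)) \<cdot>\<^bsub>B\<^esub> on_arr R (on_arr L (\<eta> Y))"
          using left.on_Comp[OF \<eta>[OF objs(2)] Rh[OF k]]
            right.on_Comp[OF left.on_arr[OF \<eta>[OF objs(2)]] left.on_arr[OF Rh[OF k]]]
          by simp
        then have "on_arr R (\<epsilon> (on_obj L Z)) \<cdot>\<^bsub>B\<^esub> on_arr R (on_arr L ?g) =
            (on_arr R (\<epsilon> (on_obj L Z)) \<cdot>\<^bsub>B\<^esub> on_arr R (on_arr L (on_arr R k))) \<cdot>\<^bsub>B\<^esub>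
              on_arr R (on_arr L (\<eta> Y))"
          using assoc[OF RL[OF \<eta>[OF objs(2)]] RLRk counit[OF objs(3)]] by simp
        also have "\<dots> = on_arr R k \<cdot>\<^bsub>B\<^esub> on_arr R (\<epsilon> (on_obj L Y)) \<cdot>\<^bsub>B\<^esub> on_arr R (on_arr L (\<eta> Y))"
          using R_counit_naturality[OF k] assoc[OF RL[OF \<eta>[OF objs(2)]] counit[OF objs(2)] Rh[OF k]]
          by simp
        also have "\<dots> = on_arr R k"
          using R_triangle_left[OF objs(2)] left.dom.Comp_Ide_right[OF Rh[OF k]]
          by (simp add: M_def)
        finally show ?thesis .
      qed
      finally show ?thesis .
    qed
    have "\<gamma> Z \<cdot>\<^bsub>B\<^esub> on_arr R (k \<cdot>\<^bsub>A\<^esub> h) \<cdot>\<^bsub>B\<^esub> \<eta> X = (\<gamma> Z \<cdot>\<^bsub>B\<^esub> on_arr R k) \<cdot>\<^bsub>B\<^esub> on_arr R h \<cdot>\<^bsub>B\<^esub> \<eta> X"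
      using right.on_Comp[OF h k] assoc[OF \<eta>[OF objs(1)] Rh[OF h] Rh[OF k]]
        assoc[OF closed[OF objs(1) h] Rh[OF k] \<gamma>[OF objs(3)]] by simp
    also have "\<dots> = ((\<gamma> Z \<cdot>\<^bsub>B\<^esub> ?g) \<cdot>\<^bsub>B\<^esub> \<gamma> Y) \<cdot>\<^bsub>B\<^esub> on_arr R h \<cdot>\<^bsub>B\<^esub> \<eta> X"
      by (simp only: absorb)
    also have "\<dots> = (\<gamma> Z \<cdot>\<^bsub>B\<^esub> ?g) \<cdot>\<^bsub>B\<^esub> \<gamma> Y \<cdot>\<^bsub>B\<^esub> on_arr R h \<cdot>\<^bsub>B\<^esub> \<eta> X"
      by (rule assoc[OF closed[OF objs(1) h] \<gamma>[OF objs(2)] comp[OF g \<gamma>[OF objs(3)]]])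
    finally show "\<gamma> Z \<cdot>\<^bsub>B\<^esub> on_arr R (k \<cdot>\<^bsub>A\<^esub> h) \<cdot>\<^bsub>B\<^esub> \<eta> X =
        (\<gamma> Z \<cdot>\<^bsub>B\<^esub> on_arr R k \<cdot>\<^bsub>B\<^esub> \<eta> Y) \<cdot>\<^bsub>B\<^esub> \<gamma> Y \<cdot>\<^bsub>B\<^esub> on_arr R h \<cdot>\<^bsub>B\<^esub> \<eta> X" .
  qed
qed

lemma h_separable_left_iff_augmentation:
  "h_separable B A L \<longleftrightarrow> (\<exists>\<gamma>. augmentation B (R \<circ>\<^sub>F L) (R \<lhd> \<epsilon> \<rhd> L) \<eta> \<gamma>)"
  unfolding h_separable_def
  using augmentation_of_heavy_section heavy_section_of_augmentation by blast

end

theorem corollary2p7: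
  fixes B :: "('o1, 'a1) category" and A :: "('o2, 'a2) category"
    and L :: "('o1, 'a1, 'o2, 'a2) functor_data" and R :: "('o2, 'a2, 'o1, 'a1) functor_data"
    and \<eta> :: "'o1 \<Rightarrow> 'a1" and \<epsilon> :: "'o2 \<Rightarrow> 'a2"
  assumes "adjunction B A L R \<eta> \<epsilon>"
  shows "(h_separable B A L \<longleftrightarrow> (\<exists>\<gamma>. augmentation B (R \<circ>\<^sub>F L) (R \<lhd> \<epsilon> \<rhd> L) \<eta> \<gamma>)) \<and>
    (h_separable A B R \<longleftrightarrow> (\<exists>\<delta>. grouplike_morphism A (L \<circ>\<^sub>F R) (L \<lhd> \<eta> \<rhd> R) \<epsilon> \<delta>))"
  using adjunction.h_separable_left_iff_augmentation[OF assms]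
    adjunction.h_separable_left_iff_augmentation[OF adjunction_opposite[OF assms]]
  by (simp add: h_separable_opposite_iff augmentation_opposite_iff)

end
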